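(* Let $\sigma_1\ge\dots\ge\sigma_n\ge0$, $\Sigma=\mathrm{Diag}(\sigma_1,\dots,\sigma_n)$, let $1\le k\le n$ and $p\ge 0$ be integers, and let $\Omega\in\mathbb{R}^{n\times(k+p)}$ be a matrix whose first $k$ rows are linearly independent. Split $\Sigma=\begin{bmatrix}\Sigma_1&0\\0&\Sigma_2\end{bmatrix}$ into blocks $\Sigma_1=\mathrm{Diag}(\sigma_1,\dots,\sigma_k)$ and $\Sigma_2=\mathrm{Diag}(\sigma_{k+1},\dots,\sigma_n)$, and split $\Omega=\begin{bmatrix}\Omega_1\\\Omega_2\end{bmatrix}$ into the first $k$ rows $\Omega_1\in\mathbb{R}^{k\times(k+p)}$ and the last $n-k$ rows $\Omega_2\in\mathbb{R}^{(n-k)\times(k+p)}$. Then $$\lambda_{\max}\big((I+\Sigma^2)^{\frac12}(I+\Sigma\mathbf{P}_\Omega\Sigma)^{-1}(I+\Sigma^2)^{\frac12}\big)\le 2+\sigma_{k+1}^2+\big\|(I+\Sigma_2^2)^{\frac12}\Omega_2\Omega_1^\dagger\big\|^2.$$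
   Context: $\mathbf{P}_\Omega=\Omega(\Omega^\top\Omega)^\dagger\Omega^\top$ is the orthogonal projector onto the range space of $\Omega$, where $^\dagger$ denotes the Moore-Penrose pseudoinverse. $\|\cdot\|$ is the spectral norm for matrices, $\lambda_{\max}$ the largest eigenvalue of a symmetric matrix, and $I$ an identity matrix of appropriate size. If $k=n$, put $\sigma_{n+1}:=0$ and let norms of empty matrices be $0$. *)

theory Defs
  imports
    "Jordan_Normal_Form.Matrix"
    "Jordan_Normal_Form.Gauss_Jordan_Elimination"
    "Jordan_Normal_Form.VS_Connect"
    "Jordan_Normal_Form.Spectral_Radius"
begin

(* Linear independence of the rows as a family, hence no repeated row. *)
definition lin_indpt_rows :: "real mat \<Rightarrow> bool" where
  "lin_indpt_rows A \<longleftrightarrow> distinct (rows A) \<and>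
     LinearCombinations.module.lin_indpt class_ring
       (module_vec TYPE(real) (dim_col A)) (set (rows A))"

(* The Moore-Penrose pseudoinverse: the unique solution of the four Penrose equations. *)
definition pinv :: "real mat \<Rightarrow> real mat" where
  "pinv A = (THE X. X \<in> carrier_mat (dim_col A) (dim_row A) \<and>
     A * X * A = A \<and> X * A * X = X \<and>
     transpose_mat (A * X) = A * X \<and> transpose_mat (X * A) = X * A)"

definition range_proj :: "real mat \<Rightarrow> real mat" where
  "range_proj A = A * pinv (transpose_mat A * A) * transpose_mat A"

definition sym_psd :: "real mat \<Rightarrow> bool" where
  "sym_psd A \<longleftrightarrow> dim_row A = dim_col A \<and> transpose_mat A = A \<and>
     (\<forall>x \<in> carrier_vec (dim_row A). 0 \<le> x \<bullet> (A *\<^sub>v x))"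

(* The principal square root; only meaningful for symmetric positive semidefinite A. *)
definition sqrt_mat :: "real mat \<Rightarrow> real mat" where
  "sqrt_mat A = (THE B. B \<in> carrier_mat (dim_row A) (dim_row A) \<and> sym_psd B \<and> B * B = A)"

(* Only meaningful for invertible A; otherwise mat_inverse returns None. *)
definition inv_mat :: "real mat \<Rightarrow> real mat" where
  "inv_mat A = the (mat_inverse A)"

(* Only meaningful for symmetric A of positive dimension. *)
definition lambda_max :: "real mat \<Rightarrow> real" where
  "lambda_max A = Max (spectrum A)"

definition eucl_norm :: "real vec \<Rightarrow> real" where
  "eucl_norm x = sqrt (x \<bullet> x)"

(* The supremum ranges over the closed unit ball rather than the sphere, so that it is
   never taken over the empty set; a matrix without rows or columns has norm 0. *)
definition spectral_norm :: "real mat \<Rightarrow> real" where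
  "spectral_norm A =
     (SUP x \<in> {x \<in> carrier_vec (dim_col A). eucl_norm x \<le> 1}. eucl_norm (A *\<^sub>v x))"

end

theory Submission
  imports Defs "HOL-Analysis.L2_Norm" "Jordan_Normal_Form.DL_Rank"
begin

text \<open>The largest eigenvalue is a maximal generalized Rayleigh quotient. By
\<open>lambda_max_congruence_inverse_le\<close> it suffices that, for all $w$ and with $y = \<Sigma> w$,
\[ \|w\|^2 + \|y\|^2 \le C (\|w\|^2 + \|P y\|^2), \]
where $P$ is the projector onto the range of $\<Omega>$ and $C$ is the right-hand side of the
theorem. Since $\|y\|^2 = \|P y\|^2 + \|e\|^2$ for the residual $e = y - P y$, this
reduces to $\|e\|^2 \le (C - 1) (\|w\|^2 + \|P y\|^2)$.

Split $e = (e_1, e_2)$ after the first $k$ entries and put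
$F = \<Omega>_2 \<Omega>_1^\dagger$. The rows of $\<Omega>_1$ are independent, so
$\<Omega>_1 \<Omega>_1^\dagger = I$, and the range of $\<Omega>$ contains all vectors $(b, F b)$.
As $e$ is orthogonal to them, $e_1 = - F^T e_2$: the large singular values, which enter
through the first block of $y$ only, have dropped out. What is left is
$e_2 = \<Sigma>_2 w_2 - (P y)_2$, which Cauchy-Schwarz bounds entry by entry in terms of $w$ and
$P y$. In $e_1 = - ((I + \<Sigma>_2^2)^{1/2} F)^T (I + \<Sigma>_2^2)^{-1/2} e_2$ the
norm from the theorem appears, and the weight that it leaves on $e_2$ is exactly
the one that cancels the constant of that Cauchy-Schwarz estimate. These are
\<open>residual_bound\<close> and \<open>projected_quadratic_form_bound\<close>.

The remaining work is to show that the operations in the statement, which are defined by unique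
description, by a supremum or by a maximum, have their expected properties: the pseudoinverse exists
and is unique (\<open>penrose_inverse_exists\<close>, \<open>penrose_inverse_unique\<close>) and yields orthogonal
projectors (\<open>range_proj_orthogonal_projector\<close>), the square roots are the diagonal ones
(\<open>sqrt_mat_diag\<close>), the spectral norm is an operator bound
(\<open>eucl_norm_mult_mat_vec_le_spectral_norm\<close>), and a real symmetric matrix has an
eigenvalue (\<open>spectrum_symmetric_nonempty\<close>).\<close>

section \<open>Euclidean and spectral norms\<close>

lemma scalar_prod_self_nonneg: "0 \<le> x \<bullet> (x :: real vec)"
  by (simp add: scalar_prod_def sum_nonneg)

lemma scalar_prod_self_eq_0_iff:
  fixes x :: "real vec"
  assumes "x \<in> carrier_vec n"
  shows "x \<bullet> x = 0 \<longleftrightarrow> x = 0\<^sub>v n"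
  using assms by (auto simp: scalar_prod_def sum_nonneg_eq_0_iff)

lemma eucl_norm_nonneg: "0 \<le> eucl_norm x"
  by (simp add: eucl_norm_def scalar_prod_self_nonneg)

lemma eucl_norm_square: "(eucl_norm x)\<^sup>2 = x \<bullet> x"
  by (simp add: eucl_norm_def scalar_prod_self_nonneg)

lemma eucl_norm_eq_L2_set: "eucl_norm x = L2_set (($) x) {0..<dim_vec x}"
  by (simp add: eucl_norm_def L2_set_def scalar_prod_def power2_eq_square)

lemma Cauchy_Schwarz_vec:
  assumes x: "x \<in> carrier_vec n" and y: "y \<in> carrier_vec n"
  shows "\<bar>x \<bullet> y\<bar> \<le> eucl_norm x * eucl_norm y"
proof -
  have "\<bar>x \<bullet> y\<bar> \<le> (\<Sum>i = 0..<n. \<bar>x $ i\<bar> * \<bar>y $ i\<bar>)"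
    using y by (auto simp: scalar_prod_def abs_mult intro: order_trans[OF sum_abs])
  also have "\<dots> \<le> eucl_norm x * eucl_norm y"
    using L2_set_mult_ineq[of "($) x" "($) y" "{0..<n}"] x y by (simp add: eucl_norm_eq_L2_set)
  finally show ?thesis .
qed

lemma eucl_norm_smult: "eucl_norm (c \<cdot>\<^sub>v x) = \<bar>c\<bar> * eucl_norm x"
proof -
  have "(c \<cdot>\<^sub>v x) \<bullet> (c \<cdot>\<^sub>v x) = c\<^sup>2 * (x \<bullet> x)"
    by (simp add: scalar_prod_def sum_distrib_left power2_eq_square algebra_simps)
  then show ?thesis by (simp add: eucl_norm_def real_sqrt_mult)
qed

text \<open>The supremum defining the spectral norm says something only if it is taken over a set that is
bounded above. The rows give a bound: by Cauchy-Schwarz, the entries of $A y$ for $y$ in the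
unit ball are at most the norms of the rows of $A$.\<close>

lemma eucl_norm_mult_mat_vec_le_spectral_norm:
  assumes A: "A \<in> carrier_mat m n" and x: "x \<in> carrier_vec n"
  shows "eucl_norm (A *\<^sub>v x) \<le> spectral_norm A * eucl_norm x"
proof (cases "eucl_norm x = 0")
  case True
  then have "x = 0\<^sub>v n"
    using eucl_norm_square[of x] scalar_prod_self_eq_0_iff[OF x] by simp
  then have "A *\<^sub>v x = 0\<^sub>v m" using A by (auto simp: scalar_prod_def)
  then show ?thesis using True by (simp add: eucl_norm_def scalar_prod_def)
next
  case False
  then have pos: "eucl_norm x > 0" using eucl_norm_nonneg[of x] by simp
  let ?S = "{x \<in> carrier_vec (dim_col A). eucl_norm x \<le> 1}"
  have bdd: "bdd_above ((\<lambda>x. eucl_norm (A *\<^sub>v x)) ` ?S)"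
  proof (rule bdd_aboveI2)
    fix y assume y: "y \<in> ?S"
    have "\<bar>row A i \<bullet> y\<bar> \<le> eucl_norm (row A i)" if "i < m" for i
    proof -
      have "\<bar>row A i \<bullet> y\<bar> \<le> eucl_norm (row A i) * eucl_norm y"
        using y A by (intro Cauchy_Schwarz_vec[of _ n]) auto
      also have "\<dots> \<le> eucl_norm (row A i)"
        using y by (simp add: mult_left_le eucl_norm_nonneg)
      finally show ?thesis .
    qed
    then have "L2_set (\<lambda>i. \<bar>row A i \<bullet> y\<bar>) {0..<m} \<le> L2_set (\<lambda>i. eucl_norm (row A i)) {0..<m}"
      by (intro L2_set_mono) auto
    moreover have "eucl_norm (A *\<^sub>v y) = L2_set (\<lambda>i. \<bar>row A i \<bullet> y\<bar>) {0..<m}"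
      using A by (auto simp: eucl_norm_eq_L2_set L2_set_def)
    ultimately show "eucl_norm (A *\<^sub>v y) \<le> L2_set (\<lambda>i. eucl_norm (row A i)) {0..<m}" by simp
  qed
  let ?y = "(1 / eucl_norm x) \<cdot>\<^sub>v x"
  have y: "?y \<in> ?S" using x A pos by (simp add: eucl_norm_smult)
  have "A *\<^sub>v ?y = (1 / eucl_norm x) \<cdot>\<^sub>v (A *\<^sub>v x)" using A x by (simp add: mult_mat_vec)
  then have "eucl_norm (A *\<^sub>v x) / eucl_norm x = eucl_norm (A *\<^sub>v ?y)"
    using pos by (simp add: eucl_norm_smult)
  also have "\<dots> \<le> spectral_norm A"
    unfolding spectral_norm_def by (rule cSUP_upper[OF y bdd])
  finally show ?thesis using pos by (simp add: field_simps)
qed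

lemma symmetric_scalar_prod:
  fixes A :: "real mat"
  assumes "A \<in> carrier_mat n n" "transpose_mat A = A" "x \<in> carrier_vec n" "y \<in> carrier_vec n"
  shows "(A *\<^sub>v x) \<bullet> y = x \<bullet> (A *\<^sub>v y)"
  using transpose_vec_mult_scalar[of A n n y x] assms by simp

lemma transpose_smult_mat: "transpose_mat (c \<cdot>\<^sub>m A) = c \<cdot>\<^sub>m transpose_mat A"
  by auto

lemma mult_unit_vec_eq_col:
  fixes A :: "real mat"
  assumes "A \<in> carrier_mat n m" "j < m"
  shows "A *\<^sub>v unit_vec m j = col A j"
  using assms by (intro eq_vecI) auto

lemma smult_mat_mult_vec:
  fixes A :: "real mat"
  assumes "A \<in> carrier_mat n m" "x \<in> carrier_vec m"
  shows "(c \<cdot>\<^sub>m A) *\<^sub>v x = c \<cdot>\<^sub>v (A *\<^sub>v x)"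
  using assms by (intro eq_vecI) (auto simp: scalar_prod_def sum_distrib_left ac_simps)

section \<open>The Moore-Penrose inverse\<close>

definition outer_prod :: "real vec \<Rightarrow> real vec \<Rightarrow> real mat" where
  "outer_prod v u = mat (dim_vec v) (dim_vec u) (\<lambda>(i, j). v $ i * u $ j)"

lemma outer_prod_carrier:
  "v \<in> carrier_vec m \<Longrightarrow> u \<in> carrier_vec n \<Longrightarrow> outer_prod v u \<in> carrier_mat m n"
  by (simp add: outer_prod_def)

lemma outer_prod_mult_vec:
  "x \<in> carrier_vec (dim_vec u) \<Longrightarrow> outer_prod v u *\<^sub>v x = (u \<bullet> x) \<cdot>\<^sub>v v"
  by (auto simp: outer_prod_def scalar_prod_def sum_distrib_left sum_distrib_right ac_simps)

lemma mult_outer_prod: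
  assumes "A \<in> carrier_mat n m" "v \<in> carrier_vec m" "u \<in> carrier_vec l"
  shows "A * outer_prod v u = outer_prod (A *\<^sub>v v) u"
  using assms
  by (intro eq_matI) (auto simp: outer_prod_def scalar_prod_def sum_distrib_left ac_simps)

text \<open>Such a $Y$ maps a vector $b$ to a minimiser of $\|A x - b\|$, and $A Y$ is the orthogonal
projector onto the column space of $A$. It is built one column at a time, as in the Gram-Schmidt
process: if $P = A Y$ projects onto the span of the first $j$ columns and $u = a - P a$ is the
residual of the next column $a$, then the next projector is $P + u u^T / \|u\|^2$. It again
has the form $A Y'$, because $u = A (e_j - Y a)$ lies in the column space of $A$.\<close>

lemma least_squares_inverse_exists:
  fixes A :: "real mat"
  assumes A: "A \<in> carrier_mat n m"
  shows "\<exists>Y \<in> carrier_mat m n. transpose_mat (A * Y) = A * Y \<and> A * Y * A = A"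
proof -
  have "\<exists>Y \<in> carrier_mat m n. transpose_mat (A * Y) = A * Y
      \<and> (\<forall>x \<in> carrier_vec n. A * Y *\<^sub>v (A * Y *\<^sub>v x) = A * Y *\<^sub>v x)
      \<and> (\<forall>i<j. A * Y *\<^sub>v col A i = col A i)" if "j \<le> m" for j
    using that
  proof (induction j)
    case 0
    have "A * 0\<^sub>m m n = 0\<^sub>m n n" using A by simp
    moreover have "0\<^sub>m n n *\<^sub>v (0\<^sub>m n n *\<^sub>v x) = 0\<^sub>m n n *\<^sub>v x" if "x \<in> carrier_vec n" for x :: "real vec"
      using that by (intro eq_vecI) (auto simp: scalar_prod_def)
    ultimately show ?case by (intro bexI[of _ "0\<^sub>m m n"]) auto
  next
    case (Suc j)
    then obtain Y where Y: "Y \<in> carrier_mat m n" and sym: "transpose_mat (A * Y) = A * Y"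
      and idem: "\<And>x. x \<in> carrier_vec n \<Longrightarrow> A * Y *\<^sub>v (A * Y *\<^sub>v x) = A * Y *\<^sub>v x"
      and fix_cols: "\<And>i. i < j \<Longrightarrow> A * Y *\<^sub>v col A i = col A i" by auto
    define P where "P = A * Y"
    have P: "P \<in> carrier_mat n n" using A Y by (simp add: P_def)
    define a where "a = col A j"
    have a: "a \<in> carrier_vec n" using A by (auto simp: a_def)
    define u where "u = a - P *\<^sub>v a"
    have u: "u \<in> carrier_vec n" using P a by (simp add: u_def)
    have Pu: "P *\<^sub>v u = 0\<^sub>v n"
      using P a idem[OF a] by (simp add: u_def mult_minus_distrib_mat_vec[of _ n n] P_def[symmetric])
    have a_eq: "a = P *\<^sub>v a + u" using P a by (auto simp: u_def)
    show ?case
    proof (cases "u = 0\<^sub>v n")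
      case True
      then have "P *\<^sub>v a = a" using a_eq P a by simp
      then have "\<And>i. i < Suc j \<Longrightarrow> A * Y *\<^sub>v col A i = col A i"
        using fix_cols by (auto simp: less_Suc_eq P_def a_def)
      then show ?thesis using Y sym idem by blast
    next
      case False
      define c where "c = u \<bullet> u"
      have c: "c \<noteq> 0" using False scalar_prod_self_eq_0_iff[OF u] by (simp add: c_def)
      \<comment> \<open>The preimage of the residual under $A$; it makes the rank-one correction factor through $A$.\<close>
      define v where "v = unit_vec m j - Y *\<^sub>v a"
      have v: "v \<in> carrier_vec m" using Y a by (simp add: v_def)
      have Av: "A *\<^sub>v v = u"
      proof -
        have "A *\<^sub>v unit_vec m j = a" using A Suc.prems by (simp add: a_def mult_unit_vec_eq_col)
        then show ?thesis using A Y a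
          by (simp add: v_def u_def P_def mult_minus_distrib_mat_vec[of _ n m])
      qed
      define Y' where "Y' = Y + (1 / c) \<cdot>\<^sub>m outer_prod v u"
      have Y': "Y' \<in> carrier_mat m n" using Y v u by (simp add: Y'_def outer_prod_carrier)
      have AY': "A * Y' = P + (1 / c) \<cdot>\<^sub>m outer_prod u u"
        using A Y v u Av outer_prod_carrier[OF v u]
        by (simp add: Y'_def P_def mult_add_distrib_mat[of _ n m] mult_smult_distrib[of _ n m]
            mult_outer_prod)
      have app: "A * Y' *\<^sub>v x = P *\<^sub>v x + ((u \<bullet> x) / c) \<cdot>\<^sub>v u" if x: "x \<in> carrier_vec n" for x
        using P u x outer_prod_carrier[OF u u] unfolding AY'
        by (simp add: add_mult_distrib_mat_vec[of _ n n] outer_prod_mult_vec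
            smult_mat_mult_vec[of _ n n] smult_smult_assoc)
      have uP: "u \<bullet> (P *\<^sub>v x) = 0" if "x \<in> carrier_vec n" for x
        using symmetric_scalar_prod[OF P _ u that] sym Pu that by (simp add: P_def)
      have "transpose_mat (A * Y') = A * Y'"
      proof -
        have "transpose_mat (outer_prod u u) = outer_prod u u"
          by (auto simp: outer_prod_def)
        then show ?thesis
          using sym P outer_prod_carrier[OF u u] unfolding AY'
          by (simp add: transpose_add[of _ n n] transpose_smult_mat P_def)
      qed
      moreover have "A * Y' *\<^sub>v (A * Y' *\<^sub>v x) = A * Y' *\<^sub>v x" if x: "x \<in> carrier_vec n" for x
      proof -
        define t where "t = (u \<bullet> x) / c"
        have Px: "P *\<^sub>v x \<in> carrier_vec n" using P x by simp
        have "t \<cdot>\<^sub>v 0\<^sub>v n = 0\<^sub>v n" by auto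
        then have "P *\<^sub>v (P *\<^sub>v x + t \<cdot>\<^sub>v u) = P *\<^sub>v x"
          using P Px u Pu idem[OF x]
          by (simp add: mult_add_distrib_mat_vec[of _ n n] mult_mat_vec[of _ n n] P_def[symmetric])
        moreover have "u \<bullet> (P *\<^sub>v x + t \<cdot>\<^sub>v u) / c = t"
          using u Px c uP[OF x] by (simp add: scalar_prod_add_distrib[of _ n] c_def)
        ultimately show ?thesis
          using app[OF x] app[of "P *\<^sub>v x + t \<cdot>\<^sub>v u"] Px u
          by (simp add: t_def[symmetric])
      qed
      moreover have "A * Y' *\<^sub>v col A i = col A i" if i: "i < Suc j" for i
      proof (cases "i = j")
        case True
        have "u \<bullet> a = c"
          using u P a uP[OF a] arg_cong[OF a_eq, of "\<lambda>x. u \<bullet> x"]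
          by (simp add: scalar_prod_add_distrib[of _ n] c_def)
        then show ?thesis using app[OF a] a_eq c u True by (simp add: a_def[symmetric])
      next
        case False
        then have fixed: "P *\<^sub>v col A i = col A i" using fix_cols i by (simp add: P_def)
        have ci: "col A i \<in> carrier_vec n" using A by auto
        have "0 \<cdot>\<^sub>v u = 0\<^sub>v n" using u by auto
        then show ?thesis using app[OF ci] uP[OF ci] u ci unfolding fixed by simp
      qed
      ultimately show ?thesis using Y' by blast
    qed
  qed
  from this[of m] obtain Y where Y: "Y \<in> carrier_mat m n"
    and sym: "transpose_mat (A * Y) = A * Y"
    and cols: "\<And>i. i < m \<Longrightarrow> A * Y *\<^sub>v col A i = col A i" by auto
  have AY: "A * Y \<in> carrier_mat n n" using A Y by simp
  have "A * Y * A = A"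
  proof (rule mat_col_eqI)
    fix i assume "i < dim_col A"
    then show "col (A * Y * A) i = col A i"
      using col_mult2[OF AY A] cols A by simp
  qed (use A Y in auto)
  then show ?thesis using Y sym by blast
qed

text \<open>The predicate that the pseudoinverse is the unique solution of, named so that existence and
uniqueness can be proved separately.\<close>

definition penrose_inverse :: "real mat \<Rightarrow> real mat \<Rightarrow> bool" where
  "penrose_inverse A X \<longleftrightarrow> X \<in> carrier_mat (dim_col A) (dim_row A) \<and>
     A * X * A = A \<and> X * A * X = X \<and>
     transpose_mat (A * X) = A * X \<and> transpose_mat (X * A) = X * A"

text \<open>Take the projectors $P = A Y$ onto the column space of $A$ and $Q = A^T W$ onto its row space.
Then $X = Q Y P$ satisfies $A X = P$ and $X A = Q$, both of which are symmetric, and the two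
remaining equations say that $P$ fixes the columns of $A$ and that $Q$ fixes the columns
of $X$.\<close>

lemma penrose_inverse_exists: "\<exists>X. penrose_inverse A X"
proof -
  define n m where "n = dim_row A" and "m = dim_col A"
  have A: "A \<in> carrier_mat n m" by (auto simp: n_def m_def)
  obtain Y where Y: "Y \<in> carrier_mat m n"
    and P: "transpose_mat (A * Y) = A * Y" and AYA: "A * Y * A = A"
    using least_squares_inverse_exists[OF A] by auto
  obtain W where W: "W \<in> carrier_mat n m"
    and Q: "transpose_mat (transpose_mat A * W) = transpose_mat A * W"
    and AWA: "transpose_mat A * W * transpose_mat A = transpose_mat A"
    using least_squares_inverse_exists[of "transpose_mat A" m n] A by auto
  define Q where "Q = transpose_mat A * W"
  have Qc: "Q \<in> carrier_mat m m" using A W by (simp add: Q_def)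
  have Qt: "Q = transpose_mat W * A"
    using Q transpose_mult[of "transpose_mat A" m n W m] A W by (simp add: Q_def)
  have AQ: "A * Q = A"
    using arg_cong[OF AWA, of transpose_mat] transpose_mult[of Q m m "transpose_mat A" n] Qc A Q
    by (simp add: Q_def)
  have QYA: "Q * (Y * A) = Q"
  proof -
    have "Q * (Y * A) = transpose_mat W * (A * Y * A)" 
      using A W Y assoc_mult_mat[of "transpose_mat W" m n A m "Y * A" m] by (simp add: Qt)
    then show ?thesis unfolding AYA Qt .
  qed
  define X where "X = Q * Y * (A * Y)"
  have X: "X \<in> carrier_mat m n" 
    using mult_carrier_mat[OF mult_carrier_mat[OF Qc Y] mult_carrier_mat[OF A Y]] by (simp add: X_def)
  have AY: "A * Y \<in> carrier_mat n n" using A Y by simp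
  have YAY: "Y * (A * Y) \<in> carrier_mat m n" using mult_carrier_mat[OF Y AY] .
  have QY: "Q * Y \<in> carrier_mat m n" using Qc Y by simp
  have X_assoc: "X = Q * (Y * (A * Y))" by (simp only: X_def assoc_mult_mat[OF Qc Y AY])
  have AX: "A * X = A * Y"
  proof -
    have "A * X = A * Q * (Y * (A * Y))" by (simp only: X_assoc assoc_mult_mat[OF A Qc YAY])
    also have "\<dots> = A * Y * A * Y"
      by (simp only: AQ assoc_mult_mat[OF AY A Y] assoc_mult_mat[OF A Y AY])
    finally show ?thesis by (simp only: AYA)
  qed
  have XA: "X * A = Q"
  proof -
    have "X * A = Q * Y * (A * Y * A)" by (simp only: X_def assoc_mult_mat[OF QY AY A])
    also have "\<dots> = Q * (Y * A)" by (simp only: AYA assoc_mult_mat[OF Qc Y A])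
    finally show ?thesis using QYA by simp
  qed
  have QQ: "Q * Q = Q"
  proof -
    have "Q * Q = transpose_mat W * (A * Q)" using A W Qc by (subst Qt) simp
    then show ?thesis unfolding AQ Qt[symmetric] .
  qed
  have "Q * X = X"
    by (simp only: X_assoc assoc_mult_mat[OF Qc Qc YAY, symmetric] QQ)
  then have "X * A * X = X" by (simp only: XA)
  then have "penrose_inverse A X"
    unfolding penrose_inverse_def AX XA using X AYA P Q by (simp add: n_def m_def Q_def)
  then show ?thesis ..
qed

text \<open>The products $A X$ and $X A$ are the same for all solutions: transposing
$A X = (A Y) (A X)$, whose factors are symmetric, gives $A X = (A X) (A Y) = A Y$, and likewise
on the other side. They determine $X = X (A X) = X (A Y) = (X A) Y = Y A Y = Y$.\<close>

lemma penrose_inverse_unique: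
  assumes X: "penrose_inverse A X" and Y: "penrose_inverse A Y"
  shows "X = Y"
proof -
  define n m where "n = dim_row A" and "m = dim_col A"
  have A: "A \<in> carrier_mat n m" by (auto simp: n_def m_def)
  note X' = X[unfolded penrose_inverse_def, folded n_def m_def]
  note Y' = Y[unfolded penrose_inverse_def, folded n_def m_def]
  have AX: "A * X = A * Y"
  proof -
    have "A * X = A * Y * (A * X)"
      using A X' Y' assoc_mult_mat[of "A * Y" n n A m X n] by (metis mult_carrier_mat)
    then have "A * X = transpose_mat (A * Y * (A * X))" using X' by simp
    also have "\<dots> = A * X * (A * Y)"
      using A X' Y' by (subst transpose_mult[of _ n n _ n]) auto
    also have "\<dots> = A * Y"
      using A X' Y' assoc_mult_mat[of "A * X" n n A m Y n] by (metis mult_carrier_mat)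
    finally show ?thesis .
  qed
  have XA: "X * A = Y * A"
  proof -
    have "X * A * (Y * A) = X * (A * Y * A)"
      using A conjunct1[OF X'] conjunct1[OF Y'] assoc_mult_mat[of X m n A m "Y * A" m] by simp
    then have "X * A = X * A * (Y * A)" using Y' by simp
    then have "X * A = transpose_mat (X * A * (Y * A))" using X' by simp
    also have "\<dots> = Y * A * (X * A)"
      using A X' Y' by (subst transpose_mult[of _ m m _ m]) auto
    also have "\<dots> = Y * (A * X * A)"
      using A conjunct1[OF X'] conjunct1[OF Y'] assoc_mult_mat[of Y m n A m "X * A" m] by simp
    also have "\<dots> = Y * A" using X' by simp
    finally show ?thesis .
  qed
  have "X = X * (A * X)"
    using X' assoc_mult_mat[OF conjunct1[OF X'] A conjunct1[OF X']] by metis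
  also have "\<dots> = X * A * Y"
    unfolding AX assoc_mult_mat[OF conjunct1[OF X'] A conjunct1[OF Y']] ..
  also have "\<dots> = Y" unfolding XA using Y' by simp
  finally show ?thesis .
qed

lemma pinv_penrose_inverse: "penrose_inverse A (pinv A)"
proof -
  have "\<exists>!X. penrose_inverse A X"
    using penrose_inverse_exists penrose_inverse_unique by blast
  then show ?thesis
    unfolding pinv_def penrose_inverse_def[symmetric] by (rule theI')
qed

lemma pinv_carrier: "A \<in> carrier_mat n m \<Longrightarrow> pinv A \<in> carrier_mat m n"
  using pinv_penrose_inverse[of A] by (auto simp: penrose_inverse_def)

text \<open>The transpose of the pseudoinverse of a symmetric matrix satisfies the same four equations, so
this is an instance of uniqueness.\<close>

lemma transpose_pinv_symmetric:
  assumes "transpose_mat A = A"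
  shows "transpose_mat (pinv A) = pinv A"
proof -
  define n where "n = dim_row A"
  have A: "A \<in> carrier_mat n n"
    using arg_cong[OF assms, of dim_row] by (auto simp: n_def)
  have X: "pinv A \<in> carrier_mat n n" using pinv_carrier[OF A] .
  note pen = pinv_penrose_inverse[of A, unfolded penrose_inverse_def]
  have AX: "transpose_mat (A * pinv A) = transpose_mat (pinv A) * A"
    using transpose_mult[OF A X] assms by simp
  have XA: "transpose_mat (pinv A * A) = A * transpose_mat (pinv A)"
    using transpose_mult[OF X A] assms by simp
  have AXt: "A * transpose_mat (pinv A) = pinv A * A" and XtA: "transpose_mat (pinv A) * A = A * pinv A"
    using AX XA pen by simp_all
  have "A * transpose_mat (pinv A) * A = A * (transpose_mat (pinv A) * A)"
    using A X by (intro assoc_mult_mat[of _ n n _ n _ n]) auto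
  also have "\<dots> = transpose_mat (A * pinv A * A)"
    using A X pen assms XtA by (subst transpose_mult[of _ n n _ n]) auto
  finally have AXtA: "A * transpose_mat (pinv A) * A = A" using pen assms by simp
  have "transpose_mat (pinv A) = transpose_mat (pinv A * A * pinv A)" using pen by simp
  also have "\<dots> = transpose_mat (pinv A) * transpose_mat (pinv A * A)"
    using A X by (intro transpose_mult[of _ n n _ n]) auto
  also have "\<dots> = transpose_mat (pinv A) * A * transpose_mat (pinv A)"
    unfolding XA using A X by (intro assoc_mult_mat[of _ n n _ n _ n, symmetric]) auto
  finally have "penrose_inverse A (transpose_mat (pinv A))"
    unfolding penrose_inverse_def AXtA using pen A X by (simp add: AXt XtA)
  then show ?thesis using penrose_inverse_unique pinv_penrose_inverse by blast
qed

text \<open>With $G = \<Omega>^T \<Omega>$ and $X = G^\dagger$, the equation $G X G = G$ gives $G r = 0$ for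
$r = X G z - z$. Hence $\|\<Omega> r\|^2 = r^T G r = 0$, that is, $\<Omega> X G z = \<Omega> z$, so
that $\<Omega> X \<Omega>^T$ fixes the range of $\<Omega>$. Idempotence follows, and symmetry is that
of $X$.\<close>

lemma range_proj_orthogonal_projector:
  assumes W: "\<Omega> \<in> carrier_mat n m"
  shows "range_proj \<Omega> \<in> carrier_mat n n" and "transpose_mat (range_proj \<Omega>) = range_proj \<Omega>"
    and "range_proj \<Omega> * range_proj \<Omega> = range_proj \<Omega>" and "range_proj \<Omega> * \<Omega> = \<Omega>"
proof -
  define G where "G = transpose_mat \<Omega> * \<Omega>"
  have G: "G \<in> carrier_mat m m" using W by (simp add: G_def)
  define X where "X = pinv G"
  have X: "X \<in> carrier_mat m m" using pinv_carrier[OF G] by (simp add: X_def)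
  have Wt: "transpose_mat \<Omega> \<in> carrier_mat m n" using W by simp
  have "transpose_mat G = G" using transpose_mult[OF Wt W] by (simp add: G_def)
  then have Xt: "transpose_mat X = X" unfolding X_def by (rule transpose_pinv_symmetric)
  have GXG: "G * X * G = G" using pinv_penrose_inverse[of G] by (simp add: penrose_inverse_def X_def)
  have P: "range_proj \<Omega> = \<Omega> * X * transpose_mat \<Omega>" by (simp add: range_proj_def X_def G_def)
  then show Pc: "range_proj \<Omega> \<in> carrier_mat n n" using W X by simp
  have WX: "\<Omega> * X \<in> carrier_mat n m" using W X by simp
  show "transpose_mat (range_proj \<Omega>) = range_proj \<Omega>"
    using transpose_mult[OF WX Wt] transpose_mult[OF W X] Xt W X by (simp add: P)
  have PW_eq: "range_proj \<Omega> * \<Omega> = \<Omega> * X * G"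
    unfolding P G_def by (rule assoc_mult_mat[OF WX Wt W])
  show PW: "range_proj \<Omega> * \<Omega> = \<Omega>"
  proof (rule eq_matI)
    fix i j assume "i < dim_row \<Omega>" "j < dim_col \<Omega>"
    then have i: "i < n" and j: "j < m" using W by auto
    define z :: "real vec" where "z = unit_vec m j"
    have z: "z \<in> carrier_vec m" by (simp add: z_def)
    define r where "r = X *\<^sub>v (G *\<^sub>v z) - z"
    have r: "r \<in> carrier_vec m" using X G z by (simp add: r_def)
    have "G *\<^sub>v r = G * X * G *\<^sub>v z - G *\<^sub>v z"
      using G X z assoc_mult_mat_vec[OF mult_carrier_mat[OF G X] G z]
      by (simp add: r_def mult_minus_distrib_mat_vec[of _ m m])
    then have Gr: "G *\<^sub>v r = 0\<^sub>v m" unfolding GXG using G z by simp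
    have Wr: "\<Omega> *\<^sub>v r \<in> carrier_vec n" using W r by simp
    have "(\<Omega> *\<^sub>v r) \<bullet> (\<Omega> *\<^sub>v r) = (transpose_mat \<Omega> *\<^sub>v (\<Omega> *\<^sub>v r)) \<bullet> r"
      using transpose_vec_mult_scalar[OF W r Wr] by simp
    also have "\<dots> = 0" using Gr W Wt r by (simp add: G_def)
    finally have "\<Omega> *\<^sub>v r = 0\<^sub>v n" using scalar_prod_self_eq_0_iff[OF Wr] by simp
    moreover have "\<Omega> *\<^sub>v r = range_proj \<Omega> * \<Omega> *\<^sub>v z - \<Omega> *\<^sub>v z"
      using W X G z assoc_mult_mat_vec[OF WX G z]
      by (simp add: r_def PW_eq mult_minus_distrib_mat_vec[of _ n m])
    ultimately have "range_proj \<Omega> * \<Omega> *\<^sub>v z - \<Omega> *\<^sub>v z = 0\<^sub>v n" by simp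
    then have "col (range_proj \<Omega> * \<Omega>) j - col \<Omega> j = 0\<^sub>v n"
      using mult_unit_vec_eq_col[of "range_proj \<Omega> * \<Omega>" n m j] mult_unit_vec_eq_col[OF W j] j Pc W
      by (simp add: z_def del: col_mult2 assoc_mult_mat_vec)
    from arg_cong[OF this, of "\<lambda>x. x $ i"]
    show "(range_proj \<Omega> * \<Omega>) $$ (i, j) = \<Omega> $$ (i, j)"
      using i j W Pc by simp
  qed (use W Pc in auto)
  have "range_proj \<Omega> * range_proj \<Omega> = range_proj \<Omega> * \<Omega> * X * transpose_mat \<Omega>"
    by (simp only: assoc_mult_mat[OF Pc WX Wt, symmetric] assoc_mult_mat[OF Pc W X, symmetric]
        arg_cong[OF P, of "\<lambda>M. range_proj \<Omega> * M"])
  then show "range_proj \<Omega> * range_proj \<Omega> = range_proj \<Omega>" unfolding PW P[symmetric] .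
qed

text \<open>The projector $A A^\dagger$ is symmetric and fixes $A$, so $A^T$ maps the columns of
$A A^\dagger - I$ to zero; independence of the rows makes $A^T$ injective.\<close>

lemma lin_indpt_rows_imp_right_inverse:
  assumes A: "A \<in> carrier_mat k m" and indep: "lin_indpt_rows A"
  shows "A * pinv A = 1\<^sub>m k"
proof -
  interpret vec_space "TYPE(real)" m .
  have X: "pinv A \<in> carrier_mat m k" using pinv_carrier[OF A] .
  have AX: "A * pinv A \<in> carrier_mat k k" using A X by simp
  note pen = pinv_penrose_inverse[of A, unfolded penrose_inverse_def]
  have inj: "v = 0\<^sub>v k" if v: "v \<in> carrier_vec k" and 0: "transpose_mat A *\<^sub>v v = 0\<^sub>v m" for v
  proof (rule ccontr)
    assume "v \<noteq> 0\<^sub>v k"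
    then have "lin_dep (set (cols (transpose_mat A)))"
      using lin_depI[of "transpose_mat A" k v] v 0 A indep by (auto simp: lin_indpt_rows_def)
    then show False using indep A by (auto simp: lin_indpt_rows_def)
  qed
  have At: "transpose_mat A * (A * pinv A) = transpose_mat A"
  proof -
    have "transpose_mat (A * pinv A * A) = transpose_mat A * transpose_mat (A * pinv A)"
      by (rule transpose_mult[OF AX A])
    then show ?thesis using pen by simp
  qed
  show ?thesis
  proof (rule mat_col_eqI)
    fix j assume "j < dim_col (1\<^sub>m k)"
    then have j: "j < k" by simp
    let ?e = "unit_vec k j"
    have e: "?e \<in> carrier_vec k" by simp
    have "transpose_mat A *\<^sub>v (A * pinv A *\<^sub>v ?e - ?e)
        = transpose_mat A * (A * pinv A) *\<^sub>v ?e - transpose_mat A *\<^sub>v ?e"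
      using A AX e by (simp add: mult_minus_distrib_mat_vec[of _ m k])
    also have "\<dots> = 0\<^sub>v m" unfolding At using A e by simp
    finally have "A * pinv A *\<^sub>v ?e - ?e = 0\<^sub>v k"
      using inj AX e by (meson minus_carrier_vec mult_mat_vec_carrier)
    moreover have "A * pinv A *\<^sub>v ?e = col (A * pinv A) j"
      by (rule mult_unit_vec_eq_col[OF AX j])
    ultimately have *: "col (A * pinv A) j - ?e = 0\<^sub>v k" by simp
    have "col (A * pinv A) j = ?e"
    proof (rule eq_vecI)
      fix i assume "i < dim_vec ?e"
      then show "col (A * pinv A) j $ i = ?e $ i"
        using arg_cong[OF *, of "\<lambda>x. x $ i"] A by simp
    qed (use A in auto)
    then show "col (A * pinv A) j = col (1\<^sub>m k) j" using j by simp
  qed (use A X in auto)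
qed

section \<open>Square roots, inverses and spectra\<close>

lemma mat_diag_mult_vec:
  "x \<in> carrier_vec n \<Longrightarrow> mat_diag n f *\<^sub>v x = vec n (\<lambda>i. f i * x $ i)" for f :: "nat \<Rightarrow> real"
  by (intro eq_vecI)
    (auto simp: mat_diag_def scalar_prod_def if_distrib[of "\<lambda>c. c * _"] cong: if_cong)

lemma transpose_mat_diag: "transpose_mat (mat_diag n f) = mat_diag n f"
  by (auto simp: mat_diag_def)

text \<open>What has to be shown is uniqueness. If $B^2 = C^2$ with $C = \mathrm{Diag}(c_i)$ and $D = B - C$,
then $B D = - D C$, so a column $x$ of $D$ satisfies $B x = - c_j x$. Since $B$ is positive
semidefinite and $c_j > 0$, this forces $x = 0$.\<close>

lemma sqrt_mat_diag:
  assumes pos: "\<And>i. i < n \<Longrightarrow> 0 < f i"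
  shows "sqrt_mat (mat_diag n f) = mat_diag n (\<lambda>i. sqrt (f i))"
proof -
  let ?A = "mat_diag n f"
  define C where "C = mat_diag n (\<lambda>i. sqrt (f i))"
  have C: "C \<in> carrier_mat n n" by (simp add: C_def)
  have dim: "dim_row ?A = n" by (simp add: mat_diag_def)
  have CC: "C * C = ?A" 
    using pos unfolding C_def mat_diag_diag by (auto simp: mat_diag_def less_imp_le)
  have "x \<bullet> (C *\<^sub>v x) = (\<Sum>i = 0..<n. sqrt (f i) * (x $ i)\<^sup>2)" if "x \<in> carrier_vec n" for x
    using that by (simp add: C_def mat_diag_mult_vec scalar_prod_def power2_eq_square ac_simps)
  moreover have "transpose_mat C = C" by (simp add: C_def transpose_mat_diag)
  ultimately have "sym_psd C"
    using pos C by (auto simp: sym_psd_def less_imp_le intro!: sum_nonneg)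
  moreover have "B = C" if B: "B \<in> carrier_mat n n" and psd: "sym_psd B" and BB: "B * B = ?A" for B
  proof -
    define D where "D = B - C"
    have D: "D \<in> carrier_mat n n" using minus_carrier_mat[OF C] by (simp add: D_def)
    have BD: "B * D = - (D * C)"
    proof -
      have "B * D = B * B - B * C" unfolding D_def by (rule mult_minus_distrib_mat[OF B B C])
      moreover have "D * C = B * C - C * C" unfolding D_def by (rule minus_mult_distrib_mat[OF B C C])
      ultimately show ?thesis 
        using B C BB CC carrier_matD[OF mat_diag_dim[of n f]] by (intro eq_matI) auto
    qed
    have "D = 0\<^sub>m n n"
    proof (rule mat_col_eqI)
      fix j assume "j < dim_col (0\<^sub>m n n :: real mat)"
      then have j: "j < n" by simp
      let ?x = "col D j"
      have x: "?x \<in> carrier_vec n" using D by auto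
      have "B *\<^sub>v ?x = col (- (D * C)) j" using col_mult2[OF B D j] BD by simp
      also have "\<dots> = (- sqrt (f j)) \<cdot>\<^sub>v ?x"
        using D C j by (auto simp: C_def mat_diag_mult_right[OF D])
      finally have "?x \<bullet> (B *\<^sub>v ?x) = - sqrt (f j) * (?x \<bullet> ?x)" using x by simp
      moreover have "0 \<le> ?x \<bullet> (B *\<^sub>v ?x)" using psd x B by (auto simp: sym_psd_def)
      moreover have "0 < sqrt (f j)" using pos j by simp
      ultimately have "?x \<bullet> ?x \<le> 0" by (simp add: mult_le_0_iff zero_le_mult_iff)
      then have "?x \<bullet> ?x = 0" using scalar_prod_self_nonneg[of ?x] by simp
      then show "?x = col (0\<^sub>m n n) j" using scalar_prod_self_eq_0_iff[OF x] j by simp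
    qed (use D in auto)
    then have "(B - C) $$ (i, j) = 0" if "i < n" "j < n" for i j using that by (simp add: D_def)
    then show ?thesis using B C by (intro eq_matI) auto
  qed
  ultimately show ?thesis
    unfolding sqrt_mat_def dim C_def[symmetric] using C CC by (intro the_equality) blast+
qed

lemma one_plus_mat_diag_square:
  "1\<^sub>m n + mat_diag n f ^\<^sub>m 2 = mat_diag n (\<lambda>i. 1 + (f i)\<^sup>2)" for f :: "nat \<Rightarrow> real"
proof -
  have "mat_diag n f ^\<^sub>m 2 = mat_diag n (\<lambda>i. f i * f i)"
    using left_mult_one_mat[OF mat_diag_dim[of n f]] carrier_matD[OF mat_diag_dim[of n f]]
    by (simp add: numeral_2_eq_2)
  then show ?thesis by (auto simp: mat_diag_def power2_eq_square)
qed

lemma sqrt_mat_one_plus_mat_diag_square: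
  "sqrt_mat (1\<^sub>m n + mat_diag n f ^\<^sub>m 2) = mat_diag n (\<lambda>i. sqrt (1 + (f i)\<^sup>2))"
  unfolding one_plus_mat_diag_square by (intro sqrt_mat_diag) (simp add: add_pos_nonneg)

lemma inv_mat_inverse:
  assumes A: "A \<in> carrier_mat n n" and "det A \<noteq> 0"
  shows "inv_mat A \<in> carrier_mat n n" "A * inv_mat A = 1\<^sub>m n" "inv_mat A * A = 1\<^sub>m n"
proof -
  have "A \<in> Units (ring_mat TYPE(real) n ())"
    using assms by (rule det_non_zero_imp_unit)
  then obtain B where "mat_inverse A = Some B"
    using mat_inverse(1)[OF A, where b = "()"] by (cases "mat_inverse A") auto
  then show "inv_mat A \<in> carrier_mat n n" "A * inv_mat A = 1\<^sub>m n" "inv_mat A * A = 1\<^sub>m n"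
    using mat_inverse(2)[OF A] by (auto simp: inv_mat_def)
qed

lemma inv_mat_symmetric:
  assumes A: "A \<in> carrier_mat n n" "det A \<noteq> 0" and sym: "transpose_mat A = A"
  shows "transpose_mat (inv_mat A) = inv_mat A"
proof -
  let ?B = "inv_mat A"
  note B = inv_mat_inverse[OF A]
  have BtA: "transpose_mat ?B * A = 1\<^sub>m n"
    using transpose_mult[OF A(1) B(1)] B(2) sym by simp
  have "transpose_mat ?B = transpose_mat ?B * (A * ?B)" using B by simp
  also have "\<dots> = transpose_mat ?B * A * ?B" using A B(1) by simp
  also have "\<dots> = ?B" unfolding BtA using B(1) by simp
  finally show ?thesis .
qed

text \<open>Over the complex numbers there is an eigenvalue $\mu$ with an eigenvector $x + i y$. Comparing
$(A x) \<bullet> y$ with $x \<bullet> (A y)$ gives $\mathrm{Im}(\mu) (\|x\|^2 + \|y\|^2) = 0$, so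
$\mu$ is real, and whichever of $x$ and $y$ is nonzero is a real eigenvector.\<close>

lemma spectrum_symmetric_nonempty:
  assumes A: "A \<in> carrier_mat n n" and n: "0 < n" and sym: "transpose_mat A = A"
  shows "spectrum (A :: real mat) \<noteq> {}"
proof -
  let ?A = "map_mat complex_of_real A"
  have Ac: "?A \<in> carrier_mat n n" using A by simp
  obtain \<mu> v where v: "v \<in> carrier_vec n" "v \<noteq> 0\<^sub>v n" and ev: "?A *\<^sub>v v = \<mu> \<cdot>\<^sub>v v"
    using spectrum_non_empty[OF Ac n] A
    by (auto simp: spectrum_def eigenvalue_def eigenvector_def)
  define x y where "x = map_vec Re v" and "y = map_vec Im v"
  have x: "x \<in> carrier_vec n" and y: "y \<in> carrier_vec n" using v by (auto simp: x_def y_def)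
  have comp: "(\<Sum>j = 0..<n. complex_of_real (A $$ (i, j)) * v $ j) = \<mu> * v $ i" if "i < n" for i
    using arg_cong[OF ev, of "\<lambda>w. w $ i"] that A v by (simp add: scalar_prod_def)
  have Ax: "A *\<^sub>v x = Re \<mu> \<cdot>\<^sub>v x - Im \<mu> \<cdot>\<^sub>v y"
    using arg_cong[OF comp, of _ Re] A v
    by (intro eq_vecI) (auto simp: scalar_prod_def x_def y_def)
  have Ay: "A *\<^sub>v y = Re \<mu> \<cdot>\<^sub>v y + Im \<mu> \<cdot>\<^sub>v x"
    using arg_cong[OF comp, of _ Im] A v
    by (intro eq_vecI) (auto simp: scalar_prod_def x_def y_def)
  have "(A *\<^sub>v x) \<bullet> y = x \<bullet> (A *\<^sub>v y)" by (rule symmetric_scalar_prod[OF A sym x y])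
  then have "Im \<mu> * (x \<bullet> x + y \<bullet> y) = 0"
    unfolding Ax Ay using x y comm_scalar_prod[OF x y]
    by (simp add: minus_scalar_prod_distrib[of _ n] scalar_prod_add_distrib[of _ n] algebra_simps)
  moreover have xy: "x \<noteq> 0\<^sub>v n \<or> y \<noteq> 0\<^sub>v n"
  proof (rule ccontr)
    assume "\<not> ?thesis"
    then have "x $ i = 0 \<and> y $ i = 0" if "i < n" for i using that by simp
    then have "v = 0\<^sub>v n"
      using v(1) by (intro eq_vecI) (auto simp: x_def y_def complex_eq_iff)
    then show False using v(2) by simp
  qed
  then have "x \<bullet> x + y \<bullet> y \<noteq> 0"
    using scalar_prod_self_eq_0_iff[OF x] scalar_prod_self_eq_0_iff[OF y]
      scalar_prod_self_nonneg[of x] scalar_prod_self_nonneg[of y]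
    by (simp add: add_nonneg_eq_0_iff)
  ultimately have "Im \<mu> = 0" by simp
  then have "A *\<^sub>v x = Re \<mu> \<cdot>\<^sub>v x" "A *\<^sub>v y = Re \<mu> \<cdot>\<^sub>v y"
    using Ax Ay x y by auto
  then have "eigenvalue A (Re \<mu>)"
    using xy x y A unfolding eigenvalue_def eigenvector_def by auto
  then show ?thesis by (auto simp: spectrum_def)
qed

text \<open>Symmetry and positive dimension guarantee that the maximum is taken over a nonempty set.\<close>

lemma lambda_max_le:
  assumes A: "A \<in> carrier_mat n n" and n: "0 < n" and sym: "transpose_mat A = A"
    and le: "\<And>\<mu> v. v \<in> carrier_vec n \<Longrightarrow> v \<noteq> 0\<^sub>v n \<Longrightarrow> A *\<^sub>v v = \<mu> \<cdot>\<^sub>v v \<Longrightarrow> \<mu> \<le> c"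
  shows "lambda_max A \<le> c"
  unfolding lambda_max_def
  using card_finite_spectrum(1)[OF A] spectrum_symmetric_nonempty[OF A n sym] le A
  by (auto simp: spectrum_def eigenvalue_def eigenvector_def)

section \<open>The residual of the projection\<close>

text \<open>This is the core estimate. Here $(e_1, e_2)$ is the residual of a projection and $N$ bounds
$D F$ in the direction $e_1$, where $D = \mathrm{Diag}(d_i)$ and $d_i^2 = 1 + \tau_i^2$. By
Cauchy-Schwarz in the plane,
$(\tau_i w_i - z_i)^2 \le (1 + \tau_i^2) (w_i^2 + z_i^2)$. Summed up, this bounds
$\|e_2\|^2$ by $(1 + s^2) (\|w\|^2 + \|z\|^2)$; divided by $d_i^2$ first, it bounds
$\|D^{-1} e_2\|^2$ by $\|w\|^2 + \|z\|^2$. The orthogonality relation now gives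
\[ \|e_1\|^2 = - (D F e_1) \<bullet> (D^{-1} e_2) \le N \|e_1\| \|D^{-1} e_2\|, \]
hence $\|e_1\|^2 \le N^2 (\|w\|^2 + \|z\|^2)$, and the two bounds add up.\<close>

lemma residual_bound:
  fixes F :: "real mat" and \<tau> :: "nat \<Rightarrow> real"
  assumes F: "F \<in> carrier_mat m k"
    and e1: "e1 \<in> carrier_vec k"
    and w: "w \<in> carrier_vec m" and z: "z \<in> carrier_vec m" and e2: "e2 \<in> carrier_vec m"
    and e2_eq: "\<And>i. i < m \<Longrightarrow> e2 $ i = \<tau> i * w $ i - z $ i"
    and \<tau>: "\<And>i. i < m \<Longrightarrow> 0 \<le> \<tau> i \<and> \<tau> i \<le> s"
    and orth: "e1 \<bullet> e1 + (F *\<^sub>v e1) \<bullet> e2 = 0"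
    and N: "eucl_norm (mat_diag m (\<lambda>i. sqrt (1 + (\<tau> i)\<^sup>2)) * F *\<^sub>v e1) \<le> N * eucl_norm e1"
  shows "e1 \<bullet> e1 + e2 \<bullet> e2 \<le> (1 + s\<^sup>2 + N\<^sup>2) * (w \<bullet> w + z \<bullet> z)"
proof -
  define d where "d i = sqrt (1 + (\<tau> i)\<^sup>2)" for i
  have d_sq: "(d i)\<^sup>2 = 1 + (\<tau> i)\<^sup>2" for i by (simp add: d_def)
  have d_pos: "0 < d i" for i by (simp add: d_def add_pos_nonneg)
  have e2_sq: "(e2 $ i)\<^sup>2 \<le> (d i)\<^sup>2 * ((w $ i)\<^sup>2 + (z $ i)\<^sup>2)" if "i < m" for i
  proof -
    \<comment> \<open>Lagrange's identity for $(\tau_i, -1)$ and $(w_i, z_i)$.\<close>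
    have "(d i)\<^sup>2 * ((w $ i)\<^sup>2 + (z $ i)\<^sup>2) - (e2 $ i)\<^sup>2 = (w $ i + \<tau> i * z $ i)\<^sup>2"
      unfolding d_sq e2_eq[OF that] by (simp add: power2_eq_square algebra_simps)
    then show ?thesis by (metis diff_ge_0_iff_ge zero_le_power2)
  qed
  have wz: "w \<bullet> w + z \<bullet> z = (\<Sum>i = 0..<m. (w $ i)\<^sup>2 + (z $ i)\<^sup>2)"
    using w z by (simp add: scalar_prod_def power2_eq_square sum.distrib)
  define q where "q = vec m (\<lambda>i. e2 $ i / d i)"
  have q: "q \<in> carrier_vec m" by (simp add: q_def)
  have qq: "q \<bullet> q \<le> w \<bullet> w + z \<bullet> z"
  proof -
    have "q \<bullet> q = (\<Sum>i = 0..<m. (e2 $ i)\<^sup>2 / (d i)\<^sup>2)"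
      by (simp add: q_def scalar_prod_def power2_eq_square)
    also have "\<dots> \<le> (\<Sum>i = 0..<m. (w $ i)\<^sup>2 + (z $ i)\<^sup>2)"
      using e2_sq d_pos by (intro sum_mono) (simp add: divide_le_eq mult.commute)
    finally show ?thesis using wz by simp
  qed
  have e2e2: "e2 \<bullet> e2 \<le> (1 + s\<^sup>2) * (w \<bullet> w + z \<bullet> z)"
  proof -
    have "e2 \<bullet> e2 = (\<Sum>i = 0..<m. (e2 $ i)\<^sup>2)"
      using e2 by (simp add: scalar_prod_def power2_eq_square)
    also have "\<dots> \<le> (\<Sum>i = 0..<m. (1 + s\<^sup>2) * ((w $ i)\<^sup>2 + (z $ i)\<^sup>2))"
    proof (rule sum_mono)
      fix i assume "i \<in> {0..<m}"
      then have i: "i < m" by simp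
      then have "(d i)\<^sup>2 \<le> 1 + s\<^sup>2" using \<tau> by (simp add: d_sq power_mono)
      then show "(e2 $ i)\<^sup>2 \<le> (1 + s\<^sup>2) * ((w $ i)\<^sup>2 + (z $ i)\<^sup>2)"
        using e2_sq[OF i] by (meson mult_right_mono order_trans sum_power2_ge_zero)
    qed
    finally show ?thesis by (simp only: wz sum_distrib_left)
  qed
  define g where "g = mat_diag m d * F *\<^sub>v e1"
  have Fe1: "F *\<^sub>v e1 \<in> carrier_vec m" using F e1 by simp
  have g_eq: "g = vec m (\<lambda>i. d i * (F *\<^sub>v e1) $ i)"
    unfolding g_def using assoc_mult_mat_vec[OF mat_diag_dim F e1] mat_diag_mult_vec[OF Fe1] by simp
  have "(F *\<^sub>v e1) \<bullet> e2 = g \<bullet> q"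
    using e2 Fe1 d_pos by (auto simp: g_eq q_def scalar_prod_def less_imp_neq[symmetric] intro!: sum.cong)
  then have "e1 \<bullet> e1 \<le> \<bar>g \<bullet> q\<bar>" using orth by linarith
  also have "\<dots> \<le> eucl_norm g * eucl_norm q"
    by (rule Cauchy_Schwarz_vec[of _ m]) (simp_all add: g_eq q)
  also have "\<dots> \<le> N * eucl_norm e1 * eucl_norm q"
    using N by (intro mult_right_mono) (auto simp: g_def d_def[abs_def] eucl_norm_nonneg)
  finally have "(eucl_norm e1)\<^sup>2 \<le> (N * eucl_norm q) * eucl_norm e1"
    by (simp add: eucl_norm_square ac_simps)
  then have "eucl_norm e1 \<le> \<bar>N * eucl_norm q\<bar>"
    using eucl_norm_nonneg[of e1]
    by (cases "eucl_norm e1 = 0") (auto simp: power2_eq_square)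
  then have "(eucl_norm e1)\<^sup>2 \<le> (N * eucl_norm q)\<^sup>2"
    using abs_le_square_iff eucl_norm_nonneg[of e1] by fastforce
  then have "e1 \<bullet> e1 \<le> N\<^sup>2 * (q \<bullet> q)" by (simp add: eucl_norm_square power_mult_distrib)
  also have "\<dots> \<le> N\<^sup>2 * (w \<bullet> w + z \<bullet> z)" using qq by (intro mult_left_mono) auto
  finally show ?thesis using e2e2 by (simp add: algebra_simps)
qed

text \<open>Decompose $y = z + e$ with $z = P y$ in the range of $P$ and $e$ orthogonal to it. For
every $b$ the range contains $\<Omega> X b = (b, \<Omega>_2 X b)$, because $X$ is a right inverse
of $\<Omega>_1$; the choice $b = e_1$ gives the orthogonality relation needed for the bound on
$\|e\|^2$, and $\|y\|^2 = \|z\|^2 + \|e\|^2$.\<close>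

lemma projected_quadratic_form_bound:
  fixes \<sigma> :: "nat \<Rightarrow> real"
  assumes k: "k \<le> n"
    and \<sigma>: "\<And>i. i < n - k \<Longrightarrow> 0 \<le> \<sigma> (i + k) \<and> \<sigma> (i + k) \<le> s"
    and \<Omega>1: "\<Omega>1 \<in> carrier_mat k m" and \<Omega>2: "\<Omega>2 \<in> carrier_mat (n - k) m"
    and X: "X \<in> carrier_mat m k" and right_inverse: "\<Omega>1 * X = 1\<^sub>m k"
    and P: "P \<in> carrier_mat n n" "transpose_mat P = P" "P * P = P"
    and P_fixes: "P * (\<Omega>1 @\<^sub>r \<Omega>2) = \<Omega>1 @\<^sub>r \<Omega>2"
    and N: "\<And>a. a \<in> carrier_vec k \<Longrightarrow>
      eucl_norm (mat_diag (n - k) (\<lambda>i. sqrt (1 + (\<sigma> (i + k))\<^sup>2)) * (\<Omega>2 * X) *\<^sub>v a) \<le> N * eucl_norm a"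
    and w: "w \<in> carrier_vec n"
  defines "y \<equiv> mat_diag n \<sigma> *\<^sub>v w"
  shows "w \<bullet> w + y \<bullet> y \<le> (2 + s\<^sup>2 + N\<^sup>2) * (w \<bullet> w + y \<bullet> (P *\<^sub>v y))"
proof -
  have y: "y \<in> carrier_vec n" using w by (simp add: y_def mat_diag_mult_vec)
  define z where "z = P *\<^sub>v y"
  have z: "z \<in> carrier_vec n" using P y by (simp add: z_def)
  define e where "e = y - z"
  have e: "e \<in> carrier_vec n" using y z by (simp add: e_def)
  have Pz: "P *\<^sub>v z = z" using assoc_mult_mat_vec[OF P(1) P(1) y] P(3) by (simp add: z_def)
  have zz: "z \<bullet> z = y \<bullet> z"
    using symmetric_scalar_prod[OF P(1,2) y z] Pz by (simp add: z_def)
  have zy: "z \<bullet> y = y \<bullet> z" using comm_scalar_prod[OF y z] by simp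
  have ee: "e \<bullet> e = y \<bullet> y - z \<bullet> z"
    using y z zz zy
    by (simp add: e_def minus_scalar_prod_distrib[of _ n] scalar_prod_minus_distrib[of _ n])
  have range_orth: "v \<bullet> e = 0" if "v \<in> carrier_vec n" "P *\<^sub>v v = v" for v
    using symmetric_scalar_prod[OF P(1,2) that(1) y] that y z
    by (simp add: e_def scalar_prod_minus_distrib[of _ n] z_def[symmetric])
  define e1 e2 where "e1 = vec_first e k" and "e2 = vec_last e (n - k)"
  define w2 z2 where "w2 = vec_last w (n - k)" and "z2 = vec_last z (n - k)"
  have split: "vec_first v k @\<^sub>v vec_last v (n - k) = v" if "v \<in> carrier_vec n" for v :: "real vec"
    using vec_first_last_append[of v k "n - k"] that k by simp
  have square_split: "v \<bullet> v = vec_first v k \<bullet> vec_first v k + vec_last v (n - k) \<bullet> vec_last v (n - k)"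
    if "v \<in> carrier_vec n" for v :: "real vec"
    using scalar_prod_append[of "vec_first v k" k "vec_last v (n - k)" "n - k"
        "vec_first v k" "vec_last v (n - k)"] split[OF that] by simp
  define a where "a = X *\<^sub>v e1"
  have e1: "e1 \<in> carrier_vec k" and e2: "e2 \<in> carrier_vec (n - k)"
    by (simp_all add: e1_def e2_def)
  have a: "a \<in> carrier_vec m" using X e1 by (simp add: a_def)
  have \<Omega>: "\<Omega>1 @\<^sub>r \<Omega>2 \<in> carrier_mat n m" using carrier_append_rows[OF \<Omega>1 \<Omega>2] k by simp
  have "\<Omega>1 *\<^sub>v a = e1"
    using assoc_mult_mat_vec[OF \<Omega>1 X e1] right_inverse e1 by (simp add: a_def)
  then have \<Omega>a: "(\<Omega>1 @\<^sub>r \<Omega>2) *\<^sub>v a = e1 @\<^sub>v (\<Omega>2 * X *\<^sub>v e1)"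
    using mat_mult_append[OF \<Omega>1 \<Omega>2 a] assoc_mult_mat_vec[OF \<Omega>2 X e1] by (simp add: a_def)
  have "((\<Omega>1 @\<^sub>r \<Omega>2) *\<^sub>v a) \<bullet> e = 0"
    using range_orth[of "(\<Omega>1 @\<^sub>r \<Omega>2) *\<^sub>v a"] assoc_mult_mat_vec[OF P(1) \<Omega> a] P_fixes \<Omega> a by simp
  then have orth: "e1 \<bullet> e1 + (\<Omega>2 * X *\<^sub>v e1) \<bullet> e2 = 0"
    using split[OF e] \<Omega>a \<Omega>2 X e1 e2
      scalar_prod_append[of e1 k "\<Omega>2 * X *\<^sub>v e1" "n - k" e1 e2]
    by (simp add: e1_def[symmetric] e2_def[symmetric])
  have "e \<bullet> e \<le> (1 + s\<^sup>2 + N\<^sup>2) * (w2 \<bullet> w2 + z2 \<bullet> z2)"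
    unfolding square_split[OF e] e1_def[symmetric] e2_def[symmetric]
  proof (rule residual_bound[where F = "\<Omega>2 * X" and \<tau> = "\<lambda>i. \<sigma> (i + k)"])
    show "e2 $ i = \<sigma> (i + k) * w2 $ i - z2 $ i" if "i < n - k" for i
    proof -
      have "y $ (k + i) = \<sigma> (k + i) * w $ (k + i)"
        using that w mat_diag_mult_vec[OF w, of \<sigma>] by (simp add: y_def)
      then show ?thesis
        using that k w z y unfolding e2_def w2_def z2_def e_def vec_last_def
        by (simp add: add.commute)
    qed
  qed (use \<Omega>2 X e1 e2 \<sigma> orth N in \<open>auto simp: w2_def z2_def\<close>)
  also have "\<dots> \<le> (1 + s\<^sup>2 + N\<^sup>2) * (w \<bullet> w + z \<bullet> z)"
    using square_split[OF w] square_split[OF z]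
      scalar_prod_self_nonneg[of "vec_first w k"] scalar_prod_self_nonneg[of "vec_first z k"]
    by (intro mult_left_mono) (auto simp: w2_def z2_def add_nonneg_nonneg)
  finally have "y \<bullet> y \<le> (1 + s\<^sup>2 + N\<^sup>2) * (w \<bullet> w + z \<bullet> z) + z \<bullet> z" using ee by simp
  then have "w \<bullet> w + y \<bullet> y \<le> (2 + s\<^sup>2 + N\<^sup>2) * (w \<bullet> w + z \<bullet> z)"
    by (simp add: algebra_simps)
  then show ?thesis using zz by (simp add: z_def)
qed

section \<open>The largest eigenvalue\<close>

text \<open>An eigenvector $v$ of $D K^{-1} D$ for $\mu$ gives $w = K^{-1} D v$ with $K w = D v$ and
$D w = \mu v$. Hence $D^2 w = \mu K w$, so $\|D w\|^2 = \mu (w \<bullet> K w)$: the eigenvalues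
are generalized Rayleigh quotients.\<close>

lemma lambda_max_congruence_inverse_le:
  fixes K :: "real mat"
  assumes n: "0 < n" and K: "K \<in> carrier_mat n n" "transpose_mat K = K"
    and pos_def: "\<And>x. x \<in> carrier_vec n \<Longrightarrow> x \<noteq> 0\<^sub>v n \<Longrightarrow> 0 < x \<bullet> (K *\<^sub>v x)"
    and d: "\<And>i. i < n \<Longrightarrow> 0 < d i"
    and le: "\<And>x. x \<in> carrier_vec n \<Longrightarrow>
      (mat_diag n d *\<^sub>v x) \<bullet> (mat_diag n d *\<^sub>v x) \<le> c * (x \<bullet> (K *\<^sub>v x))"
  shows "lambda_max (mat_diag n d * inv_mat K * mat_diag n d) \<le> c"
proof -
  define D where "D = mat_diag n d"
  have D: "D \<in> carrier_mat n n" and Dt: "transpose_mat D = D"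
    by (simp_all add: D_def transpose_mat_diag)
  have "det K \<noteq> 0"
    using det_0_iff_vec_prod_zero[OF K(1)] pos_def by fastforce
  then have B: "inv_mat K \<in> carrier_mat n n" "K * inv_mat K = 1\<^sub>m n"
    and Bt: "transpose_mat (inv_mat K) = inv_mat K"
    using inv_mat_inverse inv_mat_symmetric K by auto
  have DB: "D * inv_mat K \<in> carrier_mat n n" using D B by simp
  show ?thesis unfolding D_def[symmetric]
  proof (rule lambda_max_le[OF _ n])
    show "D * inv_mat K * D \<in> carrier_mat n n" using DB D by simp
    have "transpose_mat (D * inv_mat K * D) = D * (inv_mat K * D)"
      by (simp only: transpose_mult[OF DB D] transpose_mult[OF D B(1)] Dt Bt)
    then show "transpose_mat (D * inv_mat K * D) = D * inv_mat K * D"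
      by (simp only: assoc_mult_mat[OF D B(1) D])
  next
    fix \<mu> v
    assume v: "v \<in> carrier_vec n" "v \<noteq> 0\<^sub>v n" and ev: "D * inv_mat K * D *\<^sub>v v = \<mu> \<cdot>\<^sub>v v"
    have Dv: "D *\<^sub>v v \<in> carrier_vec n" using D v by simp
    define w where "w = inv_mat K *\<^sub>v (D *\<^sub>v v)"
    have w: "w \<in> carrier_vec n" using B Dv by (simp add: w_def)
    have Kw: "K *\<^sub>v w = D *\<^sub>v v"
      using assoc_mult_mat_vec[OF K(1) B(1) Dv] B(2) Dv by (simp add: w_def)
    have Dw: "D *\<^sub>v w = \<mu> \<cdot>\<^sub>v v"
      using ev assoc_mult_mat_vec[OF DB D v(1)] assoc_mult_mat_vec[OF D B(1) Dv] by (simp add: w_def)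
    have "w \<noteq> 0\<^sub>v n"
    proof
      assume "w = 0\<^sub>v n"
      then have "K *\<^sub>v w = 0\<^sub>v n" using K by (intro eq_vecI) (auto simp: scalar_prod_def)
      then have "D *\<^sub>v v = 0\<^sub>v n" using Kw by simp
      then have "d i * v $ i = 0" if "i < n" for i
        using mat_diag_mult_vec[OF v(1), of d] that by (metis D_def index_vec index_zero_vec(1))
      then have "v = 0\<^sub>v n" using d v(1) by (intro eq_vecI) fastforce+
      then show False using v(2) by simp
    qed
    then have pos: "0 < w \<bullet> (K *\<^sub>v w)" using pos_def w by simp
    have "(D *\<^sub>v w) \<bullet> (D *\<^sub>v w) = w \<bullet> (D *\<^sub>v (D *\<^sub>v w))"
      using D w by (intro symmetric_scalar_prod[OF D Dt]) auto
    also have "\<dots> = w \<bullet> (\<mu> \<cdot>\<^sub>v (K *\<^sub>v w))"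
      using Dw Kw mult_mat_vec[OF D v(1)] by simp
    also have "\<dots> = \<mu> * (w \<bullet> (K *\<^sub>v w))"
      using w K by simp
    finally have "\<mu> * (w \<bullet> (K *\<^sub>v w)) \<le> c * (w \<bullet> (K *\<^sub>v w))"
      using le[OF w] by (simp add: D_def)
    then show "\<mu> \<le> c" using pos by simp
  qed
qed

theorem theorem6:
  fixes n k p :: nat
    and \<sigma> :: "nat \<Rightarrow> real"
    and \<Sigma> \<Sigma>\<^sub>1 \<Sigma>\<^sub>2 \<Omega> \<Omega>\<^sub>1 \<Omega>\<^sub>2 :: "real mat"
  assumes k: "1 \<le> k" "k \<le> n"
    and \<sigma>_antimono: "\<And>i j. 1 \<le> i \<Longrightarrow> i \<le> j \<Longrightarrow> j \<le> n \<Longrightarrow> \<sigma> j \<le> \<sigma> i"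
    and \<sigma>_nonneg: "\<And>i. 1 \<le> i \<Longrightarrow> i \<le> n \<Longrightarrow> 0 \<le> \<sigma> i"
    and \<Sigma>: "\<Sigma> = mat_diag n (\<lambda>i. \<sigma> (i + 1))"
    and \<Sigma>\<^sub>1: "\<Sigma>\<^sub>1 \<in> carrier_mat k k"
    and \<Sigma>\<^sub>2: "\<Sigma>\<^sub>2 \<in> carrier_mat (n - k) (n - k)"
    and \<Sigma>_split: "\<Sigma> = four_block_mat \<Sigma>\<^sub>1 (0\<^sub>m k (n - k)) (0\<^sub>m (n - k) k) \<Sigma>\<^sub>2"
    and \<Omega>: "\<Omega> \<in> carrier_mat n (k + p)"
    and \<Omega>\<^sub>1: "\<Omega>\<^sub>1 \<in> carrier_mat k (k + p)"
    and \<Omega>\<^sub>2: "\<Omega>\<^sub>2 \<in> carrier_mat (n - k) (k + p)"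
    and \<Omega>_split: "\<Omega> = \<Omega>\<^sub>1 @\<^sub>r \<Omega>\<^sub>2"
    and indep: "lin_indpt_rows \<Omega>\<^sub>1"
  shows "lambda_max (sqrt_mat (1\<^sub>m n + \<Sigma> ^\<^sub>m 2)
             * inv_mat (1\<^sub>m n + \<Sigma> * range_proj \<Omega> * \<Sigma>)
             * sqrt_mat (1\<^sub>m n + \<Sigma> ^\<^sub>m 2))
         \<le> 2 + (if k < n then \<sigma> (k + 1) else 0)\<^sup>2
             + (spectral_norm (sqrt_mat (1\<^sub>m (n - k) + \<Sigma>\<^sub>2 ^\<^sub>m 2) * \<Omega>\<^sub>2 * pinv \<Omega>\<^sub>1))\<^sup>2"
proof -
  define f where "f i = \<sigma> (i + 1)" for i
  define s where "s = (if k < n then \<sigma> (k + 1) else 0)"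
  define P where "P = range_proj \<Omega>"
  define X where "X = pinv \<Omega>\<^sub>1"
  define D2 where "D2 = mat_diag (n - k) (\<lambda>i. sqrt (1 + (f (i + k))\<^sup>2))"
  have \<Sigma>_f: "\<Sigma> = mat_diag n f" by (simp add: \<Sigma> f_def[abs_def])
  have \<Sigma>c: "\<Sigma> \<in> carrier_mat n n" and \<Sigma>t: "transpose_mat \<Sigma> = \<Sigma>"
    by (simp_all add: \<Sigma>_f transpose_mat_diag)
  have "\<Sigma>\<^sub>2 = mat_diag (n - k) (\<lambda>i. f (i + k))"
  proof (rule eq_matI)
    fix i j
    assume "i < dim_row (mat_diag (n - k) (\<lambda>i. f (i + k)))" "j < dim_col (mat_diag (n - k) (\<lambda>i. f (i + k)))"
    then have ij: "i < n - k" "j < n - k" by (simp_all add: mat_diag_def)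
    then have "\<Sigma>\<^sub>2 $$ (i, j) = \<Sigma> $$ (i + k, j + k)"
      using \<Sigma>\<^sub>1 \<Sigma>\<^sub>2 k unfolding \<Sigma>_split by simp
    then show "\<Sigma>\<^sub>2 $$ (i, j) = mat_diag (n - k) (\<lambda>i. f (i + k)) $$ (i, j)"
      using ij by (simp add: \<Sigma>_f mat_diag_def)
  qed (use \<Sigma>\<^sub>2 in \<open>auto simp: mat_diag_def\<close>)
  then have sqrt2: "sqrt_mat (1\<^sub>m (n - k) + \<Sigma>\<^sub>2 ^\<^sub>m 2) = D2"
    by (simp add: sqrt_mat_one_plus_mat_diag_square D2_def)
  have sqrt1: "sqrt_mat (1\<^sub>m n + \<Sigma> ^\<^sub>m 2) = mat_diag n (\<lambda>i. sqrt (1 + (f i)\<^sup>2))"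
    by (simp add: \<Sigma>_f sqrt_mat_one_plus_mat_diag_square)
  have D2: "D2 \<in> carrier_mat (n - k) (n - k)" by (simp add: D2_def)
  have X: "X \<in> carrier_mat (k + p) k" using pinv_carrier[OF \<Omega>\<^sub>1] by (simp add: X_def)
  have right_inverse: "\<Omega>\<^sub>1 * X = 1\<^sub>m k"
    unfolding X_def by (rule lin_indpt_rows_imp_right_inverse[OF \<Omega>\<^sub>1 indep])
  note P = range_proj_orthogonal_projector[OF \<Omega>, folded P_def]
  define N where "N = spectral_norm (D2 * \<Omega>\<^sub>2 * X)"
  have N: "eucl_norm (D2 * (\<Omega>\<^sub>2 * X) *\<^sub>v a) \<le> N * eucl_norm a" if "a \<in> carrier_vec k" for a
    using eucl_norm_mult_mat_vec_le_spectral_norm[of "D2 * \<Omega>\<^sub>2 * X" "n - k" k a]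
      assoc_mult_mat[OF D2 \<Omega>\<^sub>2 X] D2 \<Omega>\<^sub>2 X that by (simp add: N_def)
  define K where "K = 1\<^sub>m n + \<Sigma> * P * \<Sigma>"
  have \<Sigma>P: "\<Sigma> * P \<in> carrier_mat n n" using \<Sigma>c P by simp
  have \<Sigma>P\<Sigma>: "\<Sigma> * P * \<Sigma> \<in> carrier_mat n n" using \<Sigma>P \<Sigma>c by simp
  have K: "K \<in> carrier_mat n n" using \<Sigma>P\<Sigma> by (simp add: K_def)
  have "transpose_mat (\<Sigma> * P * \<Sigma>) = \<Sigma> * (P * \<Sigma>)"
    by (simp only: transpose_mult[OF \<Sigma>P \<Sigma>c] transpose_mult[OF \<Sigma>c P(1)] \<Sigma>t P(2))
  then have "transpose_mat (\<Sigma> * P * \<Sigma>) = \<Sigma> * P * \<Sigma>"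
    by (simp only: assoc_mult_mat[OF \<Sigma>c P(1) \<Sigma>c])
  then have Kt: "transpose_mat K = K"
    using transpose_add[OF one_carrier_mat \<Sigma>P\<Sigma>] by (simp add: K_def)
  have K_form: "x \<bullet> (K *\<^sub>v x) = x \<bullet> x + (\<Sigma> *\<^sub>v x) \<bullet> (P *\<^sub>v (\<Sigma> *\<^sub>v x))"
    if x: "x \<in> carrier_vec n" for x
  proof -
    have y: "\<Sigma> *\<^sub>v x \<in> carrier_vec n" using \<Sigma>c x by simp
    have Py: "P *\<^sub>v (\<Sigma> *\<^sub>v x) \<in> carrier_vec n" using P(1) y by simp
    have "K *\<^sub>v x = x + \<Sigma> *\<^sub>v (P *\<^sub>v (\<Sigma> *\<^sub>v x))"
      using add_mult_distrib_mat_vec[OF one_carrier_mat \<Sigma>P\<Sigma> x]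
        assoc_mult_mat_vec[OF \<Sigma>P \<Sigma>c x] assoc_mult_mat_vec[OF \<Sigma>c P(1) y] x
      by (simp add: K_def)
    then show ?thesis
      using scalar_prod_add_distrib[OF x x] symmetric_scalar_prod[OF \<Sigma>c \<Sigma>t x Py] \<Sigma>c Py by simp
  qed
  have "lambda_max (mat_diag n (\<lambda>i. sqrt (1 + (f i)\<^sup>2)) * inv_mat K * mat_diag n (\<lambda>i. sqrt (1 + (f i)\<^sup>2)))
      \<le> 2 + s\<^sup>2 + N\<^sup>2"
  proof (rule lambda_max_congruence_inverse_le[OF _ K Kt])
    fix x :: "real vec"
    assume x: "x \<in> carrier_vec n"
    define y where "y = \<Sigma> *\<^sub>v x"
    have y: "y \<in> carrier_vec n" using \<Sigma>c x by (simp add: y_def)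
    have Py: "P *\<^sub>v y \<in> carrier_vec n" using P(1) y by simp
    \<comment> \<open>The form of $P$ is nonnegative, so $K$ is positive definite.\<close>
    have "y \<bullet> (P *\<^sub>v y) = (P *\<^sub>v y) \<bullet> (P *\<^sub>v y)"
      using symmetric_scalar_prod[OF P(1,2) y Py] assoc_mult_mat_vec[OF P(1) P(1) y] P(3) by simp
    then have "0 \<le> y \<bullet> (P *\<^sub>v y)" using scalar_prod_self_nonneg by simp
    moreover have "0 < x \<bullet> x" if "x \<noteq> 0\<^sub>v n"
      using that scalar_prod_self_eq_0_iff[OF x] scalar_prod_self_nonneg[of x] by linarith
    ultimately show "0 < x \<bullet> (K *\<^sub>v x)" if "x \<noteq> 0\<^sub>v n"
      using that K_form[OF x] by (simp add: y_def)
    have xx: "x \<bullet> x = (\<Sum>i = 0..<n. (x $ i)\<^sup>2)"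
      using x by (simp add: scalar_prod_def power2_eq_square)
    have yy: "y \<bullet> y = (\<Sum>i = 0..<n. (f i)\<^sup>2 * (x $ i)\<^sup>2)"
      unfolding y_def \<Sigma>_f mat_diag_mult_vec[OF x]
      by (simp add: scalar_prod_def power2_eq_square ac_simps)
    have "(mat_diag n (\<lambda>i. sqrt (1 + (f i)\<^sup>2)) *\<^sub>v x) \<bullet> (mat_diag n (\<lambda>i. sqrt (1 + (f i)\<^sup>2)) *\<^sub>v x)
        = (\<Sum>i = 0..<n. (1 + (f i)\<^sup>2) * (x $ i)\<^sup>2)"
      unfolding mat_diag_mult_vec[OF x]
      by (simp add: scalar_prod_def power2_eq_square[symmetric] power_mult_distrib)
    also have "\<dots> = x \<bullet> x + y \<bullet> y"
      by (simp add: xx yy sum.distrib distrib_right)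
    also have "\<dots> \<le> (2 + s\<^sup>2 + N\<^sup>2) * (x \<bullet> x + y \<bullet> (P *\<^sub>v y))"
      unfolding y_def \<Sigma>_f
    proof (rule projected_quadratic_form_bound[OF k(2) _ \<Omega>\<^sub>1 \<Omega>\<^sub>2 X right_inverse P(1-3) _ _ x])
      show "0 \<le> f (i + k) \<and> f (i + k) \<le> s" if i: "i < n - k" for i
      proof -
        have "k < n" "i + k + 1 \<le> n" using i by auto
        then show ?thesis
          using \<sigma>_nonneg[of "i + k + 1"] \<sigma>_antimono[of "k + 1" "i + k + 1"]
          by (simp add: f_def s_def)
      qed
    qed (use P(4) N in \<open>simp_all add: \<Omega>_split D2_def\<close>)
    finally show "(mat_diag n (\<lambda>i. sqrt (1 + (f i)\<^sup>2)) *\<^sub>v x) \<bullet> (mat_diag n (\<lambda>i. sqrt (1 + (f i)\<^sup>2)) *\<^sub>v x)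
        \<le> (2 + s\<^sup>2 + N\<^sup>2) * (x \<bullet> (K *\<^sub>v x))"
      using K_form[OF x] by (simp add: y_def)
  qed (use k in \<open>simp_all add: add_pos_nonneg\<close>)
  then show ?thesis
    by (simp only: sqrt1 sqrt2 K_def P_def N_def X_def s_def)
qed

end
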